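(* Let $(X,T)$ be a topological dynamical system. Then $(X,T)$ is weakly mean equicontinuous if and only if it is weakly density-$t$-equicontinuous for every $t\in[0,1)$.
   Context: A topological dynamical system $(X,T)$ consists of a nonempty compact metric space $X$ with metric $d$ and a continuous map $T:X\to X$. $S_n$ denotes the group of permutations of $\{1,\dots,n\}$ and $\#$ is cardinality. $(X,T)$ is weakly mean equicontinuous if for every $\varepsilon>0$ there is $\delta>0$ such that $d(x,y)<\delta$ implies $\limsup_{n\to\infty}\inf_{\sigma\in S_n}\frac1n\sum_{k=1}^n d(T^kx,T^{\sigma(k)}y)<\varepsilon$. For $t\in[0,1]$, $(X,T)$ is weakly density-$t$-equicontinuous if for any $\epsilon>0$ there is $\delta>0$ such that for any $x,y\in X$ with $d(x,y)<\delta$, $$\limsup_{n\to\infty}\frac1n\inf_{\sigma\in S_n}\#\{1\le i\le n: d(T^ix,T^{\sigma(i)}y)>\epsilon\}\le 1-t.$$ *)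

theory Defs
  imports
    "HOL-Analysis.Analysis"
    "HOL-Combinatorics.Permutations"
begin

definition topological_dynamical_system :: "'a::metric_space set \<Rightarrow> ('a \<Rightarrow> 'a) \<Rightarrow> bool" where
  "topological_dynamical_system X T \<longleftrightarrow>
     X \<noteq> {} \<and> compact X \<and> continuous_on X T \<and> T \<in> X \<rightarrow> X"

(* The limits superior below are taken in ereal, so that they always exist. *)

definition weakly_mean_equicontinuous :: "'a::metric_space set \<Rightarrow> ('a \<Rightarrow> 'a) \<Rightarrow> bool" where
  "weakly_mean_equicontinuous X T \<longleftrightarrow>
     (\<forall>\<epsilon>>0. \<exists>\<delta>>0. \<forall>x\<in>X. \<forall>y\<in>X. dist x y < \<delta> \<longrightarrow>
        limsup (\<lambda>n. ereal (INF \<sigma>\<in>{\<sigma>. \<sigma> permutes {1..n}}.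
          1 / real n * (\<Sum>k = 1..n. dist ((T ^^ k) x) ((T ^^ \<sigma> k) y)))) < ereal \<epsilon>)"

definition weakly_density_equicontinuous ::
  "real \<Rightarrow> 'a::metric_space set \<Rightarrow> ('a \<Rightarrow> 'a) \<Rightarrow> bool" where
  "weakly_density_equicontinuous t X T \<longleftrightarrow>
     (\<forall>\<epsilon>>0. \<exists>\<delta>>0. \<forall>x\<in>X. \<forall>y\<in>X. dist x y < \<delta> \<longrightarrow>
        limsup (\<lambda>n. ereal (1 / real n * real (INF \<sigma>\<in>{\<sigma>. \<sigma> permutes {1..n}}.
          card {i \<in> {1..n}. dist ((T ^^ i) x) ((T ^^ \<sigma> i) y) > \<epsilon>}))) \<le> ereal (1 - t))"

end

theory Submission
  imports Defs
begin

text \<open>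
  Both notions compare the first \<open>n\<close> points of two orbits after an optimal rearrangement, one by
  the mean of the distances, the other by the proportion of distances that exceed a
  threshold \<open>r\<close>. On a bounded space these two quantities control each other for every \<open>n\<close>.
  If \<open>D\<close> bounds all distances, then, for a fixed permutation, Markov's inequality and splitting
  the sum at \<open>r\<close> give
  \<open>r * proportion \<le> mean \<le> r + D * proportion\<close>.
  The first inequality survives the infimum when it is applied to a permutation with
  the least mean, the second when it is applied to one with the least proportion
  (\<open>least_exceeding_proportion_markov\<close>, \<open>least_mean_distance_le\<close>). So a mean that is eventually below \<open>r (1 - t)\<close> makes
  the proportion at most \<open>1 - t\<close>. Conversely, a small threshold \<open>r\<close> together with a \<open>t\<close> close
  to \<open>1\<close> makes the mean small. Compactness of \<open>X\<close> supplies the bound \<open>D\<close>.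
\<close>

definition least_mean_distance :: "('a::metric_space \<Rightarrow> 'a) \<Rightarrow> 'a \<Rightarrow> 'a \<Rightarrow> nat \<Rightarrow> real" where
  "least_mean_distance T x y n = (INF \<sigma>\<in>{\<sigma>. \<sigma> permutes {1..n}}.
     1 / real n * (\<Sum>k = 1..n. dist ((T ^^ k) x) ((T ^^ \<sigma> k) y)))"

definition least_exceeding_proportion :: "real \<Rightarrow> ('a::metric_space \<Rightarrow> 'a) \<Rightarrow> 'a \<Rightarrow> 'a \<Rightarrow> nat \<Rightarrow> real" where
  "least_exceeding_proportion r T x y n = 1 / real n * real (INF \<sigma>\<in>{\<sigma>. \<sigma> permutes {1..n}}.
     card {i \<in> {1..n}. dist ((T ^^ i) x) ((T ^^ \<sigma> i) y) > r})"

lemma INF_permutes_attained: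
  fixes f :: "('b \<Rightarrow> 'b) \<Rightarrow> 'c::conditionally_complete_linorder"
  assumes "finite S"
  obtains \<sigma> where "\<sigma> permutes S" "(INF \<sigma>\<in>{\<sigma>. \<sigma> permutes S}. f \<sigma>) = f \<sigma>"
proof -
  let ?F = "f ` {\<sigma>. \<sigma> permutes S}"
  have "finite ?F" "?F \<noteq> {}"
    using finite_permutations[OF assms] by (auto intro: permutes_id)
  then have "Inf ?F \<in> ?F"
    by (metis cInf_eq_Min Min_in)
  then show thesis
    using that by auto
qed

lemma INF_permutes_le:
  fixes f :: "('b \<Rightarrow> 'b) \<Rightarrow> 'c::conditionally_complete_linorder"
  assumes "finite S" "\<sigma> permutes S"
  shows "(INF \<sigma>\<in>{\<sigma>. \<sigma> permutes S}. f \<sigma>) \<le> f \<sigma>"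
  using assms finite_permutations[OF assms(1)]
  by (intro cINF_lower bdd_below_finite finite_imageI) auto

lemma card_exceeding_le_sum:
  fixes f :: "'b \<Rightarrow> real"
  assumes "finite I" "\<And>i. i \<in> I \<Longrightarrow> 0 \<le> f i"
  shows "r * real (card {i\<in>I. f i > r}) \<le> sum f I"
proof -
  have "r * real (card {i\<in>I. f i > r}) = (\<Sum>i\<in>{i\<in>I. f i > r}. r)"
    by simp
  also have "\<dots> \<le> sum f {i\<in>I. f i > r}"
    by (intro sum_mono) auto
  also have "\<dots> \<le> sum f I"
    using assms by (intro sum_mono2) auto
  finally show ?thesis .
qed

lemma sum_le_card_exceeding:
  fixes f :: "'b \<Rightarrow> real"
  assumes "finite I" "\<And>i. i \<in> I \<Longrightarrow> f i \<le> D" "0 \<le> r"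
  shows "sum f I \<le> r * real (card I) + D * real (card {i\<in>I. f i > r})"
proof -
  have "sum f I \<le> (\<Sum>i\<in>I. r + (if f i > r then D else 0))"
    using assms by (intro sum_mono) (auto simp: add_increasing)
  also have "\<dots> = r * real (card I) + D * real (card {i\<in>I. f i > r})"
    using assms(1) by (simp add: sum.distrib sum.If_cases Collect_conj_eq Int_commute mult.commute)
  finally show ?thesis .
qed

text \<open>Markov's inequality for a permutation that realises the least mean.\<close>

lemma least_exceeding_proportion_markov:
  assumes "0 \<le> r"
  shows "r * least_exceeding_proportion r T x y n \<le> least_mean_distance T x y n"
proof -
  define d where "d \<sigma> k = dist ((T ^^ k) x) ((T ^^ \<sigma> k) y)" for \<sigma> :: "nat \<Rightarrow> nat" and k
  define B where "B = (INF \<sigma>\<in>{\<sigma>. \<sigma> permutes {1..n}}. card {i \<in> {1..n}. d \<sigma> i > r})"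
  obtain \<sigma> where \<sigma>: "\<sigma> permutes {1..n}"
    and mean: "least_mean_distance T x y n = 1 / real n * (\<Sum>k = 1..n. d \<sigma> k)"
    unfolding least_mean_distance_def d_def by (rule INF_permutes_attained[OF finite_atLeastAtMost])
  have "B \<le> card {i \<in> {1..n}. d \<sigma> i > r}"
    unfolding B_def using \<sigma> by (intro INF_permutes_le) auto
  then have "r * real B \<le> r * real (card {i \<in> {1..n}. d \<sigma> i > r})"
    using assms by (intro mult_left_mono) auto
  also have "\<dots> \<le> (\<Sum>k = 1..n. d \<sigma> k)"
    by (rule card_exceeding_le_sum) (auto simp: d_def)
  finally have "1 / real n * (r * real B) \<le> least_mean_distance T x y n"
    unfolding mean by (intro mult_left_mono) auto
  then show ?thesis
    by (simp add: least_exceeding_proportion_def B_def d_def)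
qed

text \<open>
  In a permutation with the fewest distances above \<open>r\<close>, these are at most \<open>D\<close> and all others
  at most \<open>r\<close>.
\<close>

lemma least_mean_distance_le:
  assumes "0 \<le> r" and D: "\<And>i j. dist ((T ^^ i) x) ((T ^^ j) y) \<le> D"
  shows "least_mean_distance T x y n \<le> r + D * least_exceeding_proportion r T x y n"
proof -
  define d where "d \<sigma> k = dist ((T ^^ k) x) ((T ^^ \<sigma> k) y)" for \<sigma> :: "nat \<Rightarrow> nat" and k
  obtain \<sigma> where \<sigma>: "\<sigma> permutes {1..n}"
    and least: "(INF \<sigma>\<in>{\<sigma>. \<sigma> permutes {1..n}}. card {i \<in> {1..n}. d \<sigma> i > r})
      = card {i \<in> {1..n}. d \<sigma> i > r}"
    by (rule INF_permutes_attained[OF finite_atLeastAtMost])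
  have bad: "least_exceeding_proportion r T x y n = 1 / real n * real (card {i \<in> {1..n}. d \<sigma> i > r})"
    unfolding least_exceeding_proportion_def least[unfolded d_def] by (simp add: d_def)
  have "least_mean_distance T x y n \<le> 1 / real n * (\<Sum>k = 1..n. d \<sigma> k)"
    unfolding least_mean_distance_def d_def using \<sigma> by (intro INF_permutes_le) auto
  also have "\<dots> \<le> 1 / real n * (r * real n + D * real (card {i \<in> {1..n}. d \<sigma> i > r}))"
    using sum_le_card_exceeding[of "{1..n}" "d \<sigma>" D r] assms
    by (intro mult_left_mono) (auto simp: d_def)
  \<comment> \<open>An inequality, because the first summand is \<open>0\<close> and not \<open>r\<close> for \<open>n = 0\<close>.\<close>
  also have "\<dots> \<le> r + D * least_exceeding_proportion r T x y n"
    using assms(1) by (simp add: bad distrib_left)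
  finally show ?thesis .
qed

lemma funpow_mem:
  assumes "T \<in> X \<rightarrow> X" "x \<in> X"
  shows "(T ^^ k) x \<in> X"
  using assms by (induction k) auto

theorem proposition7p1:
  fixes X :: "'a::metric_space set" and T :: "'a \<Rightarrow> 'a"
  assumes "topological_dynamical_system X T"
  shows "weakly_mean_equicontinuous X T \<longleftrightarrow>
    (\<forall>t\<in>{0..<1::real}. weakly_density_equicontinuous t X T)"
proof
  assume mean: "weakly_mean_equicontinuous X T"
  show "\<forall>t\<in>{0..<1::real}. weakly_density_equicontinuous t X T"
    unfolding weakly_density_equicontinuous_def least_exceeding_proportion_def[symmetric]
  proof (intro ballI allI impI)
    fix t r :: real
    assume t: "t \<in> {0..<1}" and r: "r > 0"
    then have "r * (1 - t) > 0"
      by simp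
    then obtain \<delta> where "\<delta> > 0" and \<delta>: "\<And>x y. x \<in> X \<Longrightarrow> y \<in> X \<Longrightarrow> dist x y < \<delta> \<Longrightarrow>
        limsup (\<lambda>n. ereal (least_mean_distance T x y n)) < ereal (r * (1 - t))"
      using mean unfolding weakly_mean_equicontinuous_def least_mean_distance_def[symmetric] by blast
    have "limsup (\<lambda>n. ereal (least_exceeding_proportion r T x y n)) \<le> ereal (1 - t)"
      if "x \<in> X" "y \<in> X" "dist x y < \<delta>" for x y
    proof (rule Limsup_bounded)
      have "\<forall>\<^sub>F n in sequentially. ereal (least_mean_distance T x y n) < ereal (r * (1 - t))"
        using \<delta>[OF that] by (rule Limsup_lessD)
      then show "\<forall>\<^sub>F n in sequentially. ereal (least_exceeding_proportion r T x y n) \<le> ereal (1 - t)"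
      proof (rule eventually_mono)
        fix n assume "ereal (least_mean_distance T x y n) < ereal (r * (1 - t))"
        then have "least_mean_distance T x y n < r * (1 - t)"
          by simp
        then have "r * least_exceeding_proportion r T x y n \<le> r * (1 - t)"
          using least_exceeding_proportion_markov[of r T x y n] r
          by linarith
        then show "ereal (least_exceeding_proportion r T x y n) \<le> ereal (1 - t)"
          using r by (simp add: mult_le_cancel_left_pos)
      qed
    qed
    then show "\<exists>\<delta>>0. \<forall>x\<in>X. \<forall>y\<in>X. dist x y < \<delta> \<longrightarrow>
        limsup (\<lambda>n. ereal (least_exceeding_proportion r T x y n)) \<le> ereal (1 - t)"
      using \<open>\<delta> > 0\<close> by blast
  qed
next
  assume density: "\<forall>t\<in>{0..<1::real}. weakly_density_equicontinuous t X T"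
  have "bounded X" and T: "T \<in> X \<rightarrow> X"
    using assms by (auto simp: topological_dynamical_system_def compact_imp_bounded)
  then obtain D0 where D0: "\<And>x y. x \<in> X \<Longrightarrow> y \<in> X \<Longrightarrow> dist x y \<le> D0"
    unfolding bounded_two_points by blast
  show "weakly_mean_equicontinuous X T"
    unfolding weakly_mean_equicontinuous_def least_mean_distance_def[symmetric]
  proof (intro allI impI)
    fix e :: real
    assume e: "e > 0"
    \<comment> \<open>Enlarging the bound to at least \<open>e\<close> puts \<open>t\<close> into the unit interval.\<close>
    define D where "D = max D0 e"
    define t where "t = 1 - e / (4 * D)"
    have D: "D > 0" "e \<le> D"
      using e by (auto simp: D_def)
    have "t \<in> {0..<1}"
      using D e by (auto simp: t_def field_simps)
    moreover have "e / 4 > 0"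
      using e by simp
    ultimately obtain \<delta> where "\<delta> > 0" and \<delta>: "\<And>x y. x \<in> X \<Longrightarrow> y \<in> X \<Longrightarrow> dist x y < \<delta> \<Longrightarrow>
        limsup (\<lambda>n. ereal (least_exceeding_proportion (e / 4) T x y n)) \<le> ereal (1 - t)"
      using density unfolding weakly_density_equicontinuous_def least_exceeding_proportion_def[symmetric]
      by blast
    have "limsup (\<lambda>n. ereal (least_mean_distance T x y n)) < ereal e"
      if xy: "x \<in> X" "y \<in> X" "dist x y < \<delta>" for x y
    proof -
      have dist_le: "dist ((T ^^ i) x) ((T ^^ j) y) \<le> D" for i j
        using D0 funpow_mem[OF T] xy by (auto simp: D_def le_max_iff_disj)
      \<comment> \<open>A limsup at most \<open>1 - t\<close> bounds the terms eventually only by a larger constant,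
        here \<open>2 (1 - t)\<close>.\<close>
      have "ereal (1 - t) < ereal (e / (2 * D))"
        using D e by (simp add: t_def field_simps)
      then have "\<forall>\<^sub>F n in sequentially. ereal (least_exceeding_proportion (e / 4) T x y n) < ereal (e / (2 * D))"
        using \<delta>[OF xy] by (intro Limsup_lessD) (rule order.strict_trans1)
      then have "\<forall>\<^sub>F n in sequentially. ereal (least_mean_distance T x y n) \<le> ereal (3 / 4 * e)"
      proof (rule eventually_mono)
        fix n assume "ereal (least_exceeding_proportion (e / 4) T x y n) < ereal (e / (2 * D))"
        then have "D * least_exceeding_proportion (e / 4) T x y n \<le> e / 2"
          using D by (simp add: field_simps)
        then show "ereal (least_mean_distance T x y n) \<le> ereal (3 / 4 * e)"
          using least_mean_distance_le[OF _ dist_le, of "e / 4" n] e by simp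
      qed
      then have "limsup (\<lambda>n. ereal (least_mean_distance T x y n)) \<le> ereal (3 / 4 * e)"
        by (rule Limsup_bounded)
      also have "\<dots> < ereal e"
        using e by simp
      finally show ?thesis .
    qed
    then show "\<exists>\<delta>>0. \<forall>x\<in>X. \<forall>y\<in>X. dist x y < \<delta> \<longrightarrow>
        limsup (\<lambda>n. ereal (least_mean_distance T x y n)) < ereal e"
      using \<open>\<delta> > 0\<close> by blast
  qed
qed

end
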